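(* For every integer $n\ge0$ and every nonnegative integer $r$, as polynomials in $x$, \[ \sum_{k=0}^{n}S_{2,\lambda}^{(r,Y)}(n+r,k+r)(x)_{k}=\sum_{i=0}^{n}\sum_{j=i}^{n}S_{1}(j,i)\,S_{2,\lambda}^{Y}(n,j)\,(x+r)^{i}, \] where $(x)_0=1$ and $(x)_k=x(x-1)\cdots(x-k+1)$ for $k\ge1$.
   Context: Let $\lambda$ be a nonzero real number. Define $(x)_{0,\lambda}=1$ and $(x)_{n,\lambda}=x(x-\lambda)\cdots(x-(n-1)\lambda)$ for $n\ge1$, and the degenerate exponential $e_{\lambda}^{x}(t)=(1+\lambda t)^{x/\lambda}=\sum_{n\ge0}(x)_{n,\lambda}\frac{t^n}{n!}$. The Stirling numbers of the first kind $S_1(n,k)$ are defined by $(x)_n=\sum_{k=0}^n S_1(n,k)x^k$. Let $Y$ be a random variable whose moment generating function exists in a neighborhood of the origin, let $(Y_j)_{j\ge1}$ be mutually independent copies of $Y$, and set $S_0=0$, $S_k=Y_1+\cdots+Y_k$ for $k\ge1$. The probabilistic degenerate Stirling numbers of the second kind associated with $Y$ are defined by $\frac{1}{k!}\big(E[e_{\lambda}^{Y}(t)]-1\big)^{k}=\sum_{n=k}^{\infty}S_{2,\lambda}^{Y}(n,k)\frac{t^n}{n!}$. For $r$ a nonnegative integer, the probabilistic degenerate $r$-Stirling numbers of the second kind associated with $Y$ are defined by \[ \frac{1}{k!}\Big(E\big[e_{\lambda}^{Y}(t)\big]-1\Big)^{k}E\big[e_{\lambda}^{S_r}(t)\big]=\sum_{n=k}^{\infty}S_{2,\lambda}^{(r,Y)}(n+r,k+r)\frac{t^n}{n!},\quad(k\ge0).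 \] *)

theory Defs
  imports
    "HOL-Probability.Probability"
    "HOL-Analysis.FPS_Convergence"
begin

definition degenerate_exp :: "real \<Rightarrow> real \<Rightarrow> real \<Rightarrow> real" where
  "degenerate_exp lam x t = (1 + lam * t) powr (x / lam)"

text \<open>
  \<open>egf_coeff f n\<close> is the coefficient of \<open>t ^ n / n!\<close> in the power series expansion of the
  function \<open>f\<close> around \<open>0\<close>. It only depends on the values of \<open>f\<close> near \<open>0\<close>, and it is
  meaningful only if \<open>f\<close> is analytic there.
\<close>
definition egf_coeff :: "(real \<Rightarrow> real) \<Rightarrow> nat \<Rightarrow> real" where
  "egf_coeff f n = fact n * fps_nth (THE F. f has_fps_expansion F) n"

lemma egf_coeff_eqI:
  assumes "f has_fps_expansion F"
  shows "egf_coeff f n = fact n * fps_nth F n"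
proof -
  have "G = F" if G: "f has_fps_expansion G" for G
  proof -
    have "(\<lambda>x. f x - f x) has_fps_expansion (G - F)"
      by (intro has_fps_expansion_diff assms G)
    then have H: "(\<lambda>_. 0) has_fps_expansion (G - F)"
      by simp
    have "(\<lambda>_. 0) has_fps_expansion ((fps_deriv ^^ m) (G - F))" for m
    proof (induction m)
      case (Suc m)
      have "deriv (\<lambda>_::real. 0::real) = (\<lambda>_. 0)"
        by (rule ext) simp
      then show ?case
        using has_fps_expansion_deriv[OF Suc.IH] by simp
    qed (simp add: H)
    then have "eval_fps ((fps_deriv ^^ m) (G - F)) 0 = 0" for m
      unfolding has_fps_expansion_def by (blast dest: eventually_nhds_x_imp_x)
    then have "fps_nth ((fps_deriv ^^ m) (G - F)) 0 = 0" for m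
      by (simp only: eval_fps_at_0)
    then have "fps_nth (G - F) m = 0" for m
      by (simp only: fps_0th_higher_deriv) simp
    then show ?thesis
      by (simp add: fps_eq_iff)
  qed
  then have "(THE F. f has_fps_expansion F) = F"
    by (rule the_equality[where P = "\<lambda>F. f has_fps_expansion F", OF assms])
  then show ?thesis
    by (simp add: egf_coeff_def)
qed

definition falling_poly :: "nat \<Rightarrow> real poly" where
  "falling_poly n = (\<Prod>i<n. [:- of_nat i, 1:])"

text \<open>The Stirling numbers of the first kind are the signed ones.\<close>
definition S1 :: "nat \<Rightarrow> nat \<Rightarrow> real" where
  "S1 n k = poly.coeff (falling_poly n) k"

lemma falling_poly_eq_sum_S1: "falling_poly n = (\<Sum>k\<le>n. smult (S1 n k) ([:0, 1:] ^ k))"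
proof -
  have "degree (falling_poly n) \<le> (\<Sum>i<n. degree [:- of_nat i, 1 :: real:])"
    unfolding falling_poly_def by (rule degree_prod_sum_le[unfolded o_def]) auto
  then have "degree (falling_poly n) \<le> n"
    by simp
  then show ?thesis
    using poly_as_sum_of_monoms'[of "falling_poly n" n]
    by (simp add: S1_def monom_altdef)
qed

context prob_space
begin

text \<open>
  Each generating function below is \<open>O(t ^ k)\<close> at \<open>0\<close>, so the coefficients of index
  \<open>n < k\<close> vanish and the expansion effectively starts at \<open>n = k\<close>.
\<close>
definition prob_deg_stirling2 :: "real \<Rightarrow> ('a \<Rightarrow> real) \<Rightarrow> nat \<Rightarrow> nat \<Rightarrow> real" where
  "prob_deg_stirling2 lam Y n k =
     egf_coeff (\<lambda>t. (expectation (\<lambda>\<omega>. degenerate_exp lam (Y \<omega>) t) - 1) ^ k / fact k) n"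

text \<open>
  \<open>Ys j\<close> is meant to be the \<open>j\<close>-th independent copy of \<open>Y\<close> for \<open>j \<ge> 1\<close>; \<open>Ys 0\<close> is not used.
  Both indices of the \<open>r\<close>-Stirling numbers are shifted by \<open>r\<close>: the value at \<open>(n + r, k + r)\<close> is
  the coefficient of \<open>t ^ n / n!\<close> in the \<open>k\<close>-th generating function. Arguments smaller
  than \<open>r\<close> carry no meaning.
\<close>
definition prob_deg_r_stirling2 ::
  "real \<Rightarrow> nat \<Rightarrow> ('a \<Rightarrow> real) \<Rightarrow> (nat \<Rightarrow> 'a \<Rightarrow> real) \<Rightarrow> nat \<Rightarrow> nat \<Rightarrow> real" where
  "prob_deg_r_stirling2 lam r Y Ys N K =
     egf_coeff (\<lambda>t. (expectation (\<lambda>\<omega>. degenerate_exp lam (Y \<omega>) t) - 1) ^ (K - r) / fact (K - r)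
                    * expectation (\<lambda>\<omega>. degenerate_exp lam (\<Sum>j=1..r. Ys j \<omega>) t)) (N - r)"

end

end

theory Submission
  imports Defs
begin

text \<open>
  Let \<open>F\<close> be the power series of \<open>t \<mapsto> E[e\<^sub>\<lambda>\<^sup>Y(t)]\<close>. It exists because \<open>e\<^sub>\<lambda>\<^sup>Y(t)\<close> is a binomial series
  in \<open>\<lambda> t\<close> with exponent \<open>Y / \<lambda>\<close>, dominated by \<open>exp (s \<bar>Y\<bar>)\<close> with \<open>s \<rightarrow> 0\<close> as \<open>t \<rightarrow> 0\<close>. By
  independence, \<open>E[e\<^sub>\<lambda>\<^bsup>S_r\<^esup>(t)]\<close> has the series \<open>F ^ r\<close>. At \<open>x = m \<in> \<nat>\<close> both sides of the identity
  become \<open>n!\<close> times the \<open>n\<close>-th coefficient of \<open>F ^ (m + r)\<close>: expand \<open>F ^ m\<close> respectively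
  \<open>F ^ (m + r)\<close> in powers of \<open>F - 1\<close>, which has no constant term. Two polynomials that
  agree on the natural numbers are equal.
\<close>

section \<open>Absolute bounds for the binomial series and interchange with the integral\<close>

lemma abs_gbinomial_le:
  fixes a :: real
  shows "\<bar>a gchoose n\<bar> \<le> (-1) ^ n * (- \<bar>a\<bar> gchoose n)"
proof -
  \<comment> \<open>The majorant is a rising factorial of \<open>\<bar>a\<bar>\<close>; the sign
    \<open>(-1) ^ n\<close> of the lemma is what turns it into a binomial coefficient at
    \<open>- \<bar>a\<bar>\<close>.\<close>
  have "\<bar>\<Prod>i=0..<n. a - of_nat i\<bar> \<le> (\<Prod>i=0..<n. \<bar>a\<bar> + of_nat i)"
    unfolding abs_prod by (rule prod_mono) auto
  also have "\<dots> = (\<Prod>i=0..<n. (-1) * (- \<bar>a\<bar> - of_nat i))"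
    by (intro prod.cong) auto
  also have "\<dots> = (-1) ^ n * (\<Prod>i=0..<n. - \<bar>a\<bar> - of_nat i)"
    by (subst prod.distrib) simp
  finally show ?thesis
    by (simp add: gbinomial_prod_rev abs_divide divide_right_mono)
qed

text \<open>By \<open>abs_gbinomial_le\<close> the absolute values are dominated term by term by the
  binomial series of \<open>(1 - \<bar>z\<bar>) powr (- \<bar>a\<bar>)\<close>, whose terms are
  nonnegative, so its partial sums stay below its value.\<close>

lemma sum_abs_binomial_series_le:
  fixes a z :: real
  assumes "\<bar>z\<bar> < 1"
  shows "(\<Sum>n<N. \<bar>(a gchoose n) * z ^ n\<bar>) \<le> (1 - \<bar>z\<bar>) powr (- \<bar>a\<bar>)"
proof -
  let ?g = "\<lambda>n. (- \<bar>a\<bar> gchoose n) * (- \<bar>z\<bar>) ^ n"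
  have le: "\<bar>(a gchoose n) * z ^ n\<bar> \<le> ?g n" for n
  proof -
    have "\<bar>(a gchoose n) * z ^ n\<bar> = \<bar>a gchoose n\<bar> * \<bar>z\<bar> ^ n"
      by (simp add: abs_mult power_abs)
    also have "\<dots> \<le> (-1) ^ n * (- \<bar>a\<bar> gchoose n) * \<bar>z\<bar> ^ n"
      by (intro mult_right_mono abs_gbinomial_le) auto
    also have "\<dots> = ?g n"
      by (simp add: power_minus[of "\<bar>z\<bar>"] mult_ac)
    finally show ?thesis .
  qed
  have sums: "?g sums (1 - \<bar>z\<bar>) powr (- \<bar>a\<bar>)"
    using gen_binomial_real[of "- \<bar>z\<bar>" "- \<bar>a\<bar>"] assms by simp
  have nonneg: "0 \<le> ?g n" for n
    using le[of n] by (rule order_trans[OF abs_ge_zero])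
  have "(\<Sum>n<N. \<bar>(a gchoose n) * z ^ n\<bar>) \<le> (\<Sum>n<N. ?g n)"
    by (intro sum_mono le)
  also have "\<dots> \<le> suminf ?g"
    using sums nonneg by (intro sum_le_suminf) (auto simp: sums_iff)
  finally show ?thesis
    using sums by (simp add: sums_iff)
qed

text \<open>The single majorant \<open>D\<close> of the absolute partial sums bounds every term, the
  pointwise sums and the sums of the integrals of the norms, which is what termwise integration
  requires.\<close>

lemma integrable_sums_integral_dominated:
  fixes f :: "nat \<Rightarrow> 'a \<Rightarrow> real"
  assumes meas: "\<And>n. f n \<in> borel_measurable M"
    and D: "integrable M D"
    and le: "\<And>N x. x \<in> space M \<Longrightarrow> (\<Sum>n<N. \<bar>f n x\<bar>) \<le> D x"
    and sums: "\<And>x. x \<in> space M \<Longrightarrow> (\<lambda>n. f n x) sums S x"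
  shows "integrable M S" and "(\<lambda>n. integral\<^sup>L M (f n)) sums integral\<^sup>L M S"
proof -
  have le1: "\<bar>f n x\<bar> \<le> D x" if "x \<in> space M" for n x
  proof -
    have "\<bar>f n x\<bar> \<le> (\<Sum>i<Suc n. \<bar>f i x\<bar>)"
      by (simp add: sum_nonneg)
    also have "\<dots> \<le> D x"
      by (rule le[OF that])
    finally show ?thesis .
  qed
  have int: "integrable M (f n)" for n
    by (rule Bochner_Integration.integrable_bound[OF D meas])
       (use le1 in \<open>auto intro!: AE_I2 intro: order_trans[OF _ abs_ge_self]\<close>)
  have AE: "AE x in M. summable (\<lambda>n. norm (f n x))"
  proof (rule AE_I2)
    fix x assume "x \<in> space M"
    then show "summable (\<lambda>n. norm (f n x))"
      using le by (intro summableI_nonneg_bounded[of _ "D x"]) auto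
  qed
  have summ: "summable (\<lambda>n. \<integral>x. norm (f n x) \<partial>M)"
  proof (rule summableI_nonneg_bounded)
    fix N
    have "(\<Sum>n<N. \<integral>x. norm (f n x) \<partial>M) = (\<integral>x. (\<Sum>n<N. norm (f n x)) \<partial>M)"
      by (rule Bochner_Integration.integral_sum[symmetric]) (intro integrable_norm int)
    also have "\<dots> \<le> integral\<^sup>L M D"
      using le by (intro integral_mono D Bochner_Integration.integrable_sum integrable_norm int) auto
    finally show "(\<Sum>n<N. \<integral>x. norm (f n x) \<partial>M) \<le> integral\<^sup>L M D" .
  qed simp
  have S: "(\<Sum>n. f n x) = S x" if "x \<in> space M" for x
    using sums[OF that] by (simp add: sums_iff)
  show "integrable M S"
    using integrable_suminf[OF int AE summ] S by (simp cong: Bochner_Integration.integrable_cong)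
  show "(\<lambda>n. integral\<^sup>L M (f n)) sums integral\<^sup>L M S"
    using sums_integral[OF int AE summ] S by (simp cong: Bochner_Integration.integral_cong)
qed

text \<open>The integrand equals one of the two given exponentials at each point, and the other one
  is positive.\<close>

lemma integrable_exp_mult_abs:
  fixes Y :: "'a \<Rightarrow> real"
  assumes [measurable]: "Y \<in> borel_measurable M"
    and "integrable M (\<lambda>\<omega>. exp (s * Y \<omega>))" "integrable M (\<lambda>\<omega>. exp (- s * Y \<omega>))"
  shows "integrable M (\<lambda>\<omega>. exp (s * \<bar>Y \<omega>\<bar>))"
proof (rule Bochner_Integration.integrable_bound[OF Bochner_Integration.integrable_add[OF assms(2,3)]])
  show "AE \<omega> in M. norm (exp (s * \<bar>Y \<omega>\<bar>)) \<le> norm (exp (s * Y \<omega>) + exp (- s * Y \<omega>))"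
    by (intro AE_I2) (simp add: abs_of_pos[OF add_pos_pos] abs_if[of "Y _"])
qed measurable

section \<open>Power series of the expected degenerate exponential\<close>

lemma degenerate_exp_measurable [measurable]:
  "(\<lambda>x. degenerate_exp lam x t) \<in> borel_measurable borel"
  unfolding degenerate_exp_def by measurable

lemma degenerate_exp_sum:
  assumes "finite A" "1 + lam * t > 0"
  shows "degenerate_exp lam (\<Sum>j\<in>A. f j) t = (\<Prod>j\<in>A. degenerate_exp lam (f j) t)"
  using assms by (simp add: degenerate_exp_def sum_divide_distrib powr_sum)

text \<open>The binomial series in \<open>lam * t\<close> with exponent
  \<open>Y \<omega> / lam\<close> is integrated term by term.\<close>

lemma has_fps_expansion_expectation_degenerate_exp:
  fixes Y :: "'a \<Rightarrow> real"
  assumes lam: "lam \<noteq> 0"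
    and [measurable]: "Y \<in> borel_measurable M"
    and mgf: "\<exists>\<epsilon>>0. \<forall>s. \<bar>s\<bar> < \<epsilon> \<longrightarrow> integrable M (\<lambda>\<omega>. exp (s * Y \<omega>))"
  shows "\<forall>\<^sub>F t in nhds 0. integrable M (\<lambda>\<omega>. degenerate_exp lam (Y \<omega>) t)"
    and "(\<lambda>t. \<integral>\<omega>. degenerate_exp lam (Y \<omega>) t \<partial>M) has_fps_expansion
           Abs_fps (\<lambda>n. \<integral>\<omega>. (Y \<omega> / lam gchoose n) * lam ^ n \<partial>M)"
proof -
  obtain \<epsilon> where \<epsilon>: "\<epsilon> > 0" "\<And>s. \<bar>s\<bar> < \<epsilon> \<Longrightarrow> integrable M (\<lambda>\<omega>. exp (s * Y \<omega>))"
    using mgf by blast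
  \<comment> \<open>Chosen so that the bound of \<open>sum_abs_binomial_series_le\<close> becomes
    \<open>exp (s t * \<bar>Y \<omega>\<bar>)\<close>. As \<open>s\<close> is continuous at 0 with
    value 0, small \<open>t\<close> keep \<open>s t\<close> in the interval where the moment
    generating function exists.\<close>
  define s where "s t = - ln (1 - \<bar>lam * t\<bar>) / \<bar>lam\<bar>" for t
  have "isCont s 0"
    unfolding s_def using lam by (intro continuous_intros) auto
  then have "(s \<longlongrightarrow> 0) (nhds 0)"
    using tendsto_at_iff_tendsto_nhds[of s 0] by (simp add: isCont_def s_def)
  then have ev_s: "\<forall>\<^sub>F t in nhds 0. \<bar>s t\<bar> < \<epsilon>"
    using \<epsilon>(1) by (auto dest!: tendstoD simp: dist_real_def)
  have "((\<lambda>t. \<bar>lam * t\<bar>) \<longlongrightarrow> \<bar>lam * 0\<bar>) (nhds 0)"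
    by (intro tendsto_intros filterlim_ident)
  then have ev_lt: "\<forall>\<^sub>F t in nhds 0. \<bar>lam * t\<bar> < 1"
    by (auto dest!: order_tendstoD(2)[of _ _ _ 1])
  define f where "f t n \<omega> = (Y \<omega> / lam gchoose n) * (lam * t) ^ n" for t n \<omega>
  have meas: "f t n \<in> borel_measurable M" for t n
    unfolding f_def[abs_def] gbinomial_prod_rev by measurable
  have main: "integrable M (\<lambda>\<omega>. degenerate_exp lam (Y \<omega>) t) \<and>
      (\<lambda>n. integral\<^sup>L M (f t n)) sums (\<integral>\<omega>. degenerate_exp lam (Y \<omega>) t \<partial>M)"
    if t: "\<bar>s t\<bar> < \<epsilon>" "\<bar>lam * t\<bar> < 1" for t
  proof -
    have D: "integrable M (\<lambda>\<omega>. exp (s t * \<bar>Y \<omega>\<bar>))"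
      using t(1) by (intro integrable_exp_mult_abs \<epsilon>(2)) auto
    have le: "(\<Sum>n<N. \<bar>f t n \<omega>\<bar>) \<le> exp (s t * \<bar>Y \<omega>\<bar>)" for N \<omega>
    proof -
      have "(\<Sum>n<N. \<bar>f t n \<omega>\<bar>) \<le> (1 - \<bar>lam * t\<bar>) powr (- \<bar>Y \<omega> / lam\<bar>)"
        unfolding f_def by (rule sum_abs_binomial_series_le[OF t(2)])
      also have "\<dots> = exp (s t * \<bar>Y \<omega>\<bar>)"
        using t(2) by (simp add: powr_def s_def abs_divide field_simps)
      finally show ?thesis .
    qed
    have "(\<lambda>n. f t n \<omega>) sums degenerate_exp lam (Y \<omega>) t" for \<omega>
      unfolding f_def degenerate_exp_def by (rule gen_binomial_real[OF t(2)])
    from integrable_sums_integral_dominated[OF meas D le this] show ?thesis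
      by blast
  qed
  show "\<forall>\<^sub>F t in nhds 0. integrable M (\<lambda>\<omega>. degenerate_exp lam (Y \<omega>) t)"
    using ev_s ev_lt by eventually_elim (use main in blast)
  show "(\<lambda>t. \<integral>\<omega>. degenerate_exp lam (Y \<omega>) t \<partial>M) has_fps_expansion
           Abs_fps (\<lambda>n. \<integral>\<omega>. (Y \<omega> / lam gchoose n) * lam ^ n \<partial>M)"
  proof (rule has_fps_expansionI)
    \<comment> \<open>Pulling out \<open>t ^ n\<close> leaves coefficients that are free of
      \<open>t\<close>.\<close>
    have "integral\<^sup>L M (f t n) = (\<integral>\<omega>. (Y \<omega> / lam gchoose n) * lam ^ n \<partial>M) * t ^ n" for t n
      unfolding f_def power_mult_distrib mult.assoc[symmetric] by (rule integral_mult_left_zero)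
    with main have main': "(\<lambda>n. (\<integral>\<omega>. (Y \<omega> / lam gchoose n) * lam ^ n \<partial>M) * t ^ n)
        sums (\<integral>\<omega>. degenerate_exp lam (Y \<omega>) t \<partial>M)" if "\<bar>s t\<bar> < \<epsilon>" "\<bar>lam * t\<bar> < 1" for t
      using that by simp
    show "\<forall>\<^sub>F t in nhds 0. (\<lambda>n. fps_nth (Abs_fps (\<lambda>n. \<integral>\<omega>. (Y \<omega> / lam gchoose n) * lam ^ n \<partial>M)) n * t ^ n)
        sums (\<integral>\<omega>. degenerate_exp lam (Y \<omega>) t \<partial>M)"
      using ev_s ev_lt by eventually_elim (use main' in simp)
  qed
qed

text \<open>Independence turns the expectation of the product into a product of expectations, and
  each factor depends only on the common distribution.\<close>

lemma (in prob_space) expectation_degenerate_exp_sum: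
  fixes Y :: "'a \<Rightarrow> real"
  assumes "Y \<in> borel_measurable M"
    and indep: "indep_vars (\<lambda>_. borel) Ys A"
    and distr: "\<And>j. j \<in> A \<Longrightarrow> distr M borel (Ys j) = distr M borel Y"
    and "finite A" "1 + lam * t > 0"
    and int: "integrable M (\<lambda>\<omega>. degenerate_exp lam (Y \<omega>) t)"
  shows "expectation (\<lambda>\<omega>. degenerate_exp lam (\<Sum>j\<in>A. Ys j \<omega>) t) =
    expectation (\<lambda>\<omega>. degenerate_exp lam (Y \<omega>) t) ^ card A"
proof -
  have meas: "Ys j \<in> borel_measurable M" if "j \<in> A" for j
    using indep that by (auto simp: indep_vars_def)
  have int_Ys: "integrable M (\<lambda>\<omega>. degenerate_exp lam (Ys j \<omega>) t)" if "j \<in> A" for j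
    using int distr[OF that] integrable_distr_eq[OF meas[OF that] degenerate_exp_measurable]
      integrable_distr_eq[OF assms(1) degenerate_exp_measurable] by metis
  have exp_Ys: "expectation (\<lambda>\<omega>. degenerate_exp lam (Ys j \<omega>) t) =
      expectation (\<lambda>\<omega>. degenerate_exp lam (Y \<omega>) t)" if "j \<in> A" for j
    using distr[OF that] integral_distr[OF meas[OF that] degenerate_exp_measurable]
      integral_distr[OF assms(1) degenerate_exp_measurable] by metis
  have "expectation (\<lambda>\<omega>. degenerate_exp lam (\<Sum>j\<in>A. Ys j \<omega>) t) =
      expectation (\<lambda>\<omega>. \<Prod>j\<in>A. degenerate_exp lam (Ys j \<omega>) t)"
    using assms by (simp add: degenerate_exp_sum)
  also have "\<dots> = (\<Prod>j\<in>A. expectation (\<lambda>\<omega>. degenerate_exp lam (Ys j \<omega>) t))"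
    by (intro indep_vars_lebesgue_integral indep_vars_compose2[OF indep] assms int_Ys) auto
  finally show ?thesis
    using exp_Ys by simp
qed

section \<open>Formal power series and polynomial identities\<close>

lemma has_fps_expansion_power_nat:
  fixes F :: "'a :: {banach, real_normed_field} fps"
  assumes "f has_fps_expansion F"
  shows "(\<lambda>x. f x ^ k) has_fps_expansion F ^ k"
  using has_fps_expansion_prod[of "{..<k}" "\<lambda>_. f" "\<lambda>_. F"] assms by simp

text \<open>Needed because the product formula for the expectation at the sum of the copies is
  available only near 0.\<close>

lemma has_fps_expansion_eventually_cong:
  assumes "f has_fps_expansion F" "\<forall>\<^sub>F x in nhds 0. f x = g x"
  shows "g has_fps_expansion F"
proof -
  have "\<forall>\<^sub>F x in nhds 0. eval_fps F x = f x" and "fps_conv_radius F > 0"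
    using assms(1) by (auto simp: has_fps_expansion_def)
  moreover from this(1) assms(2) have "\<forall>\<^sub>F x in nhds 0. eval_fps F x = g x"
    by eventually_elim simp
  ultimately show ?thesis
    by (simp add: has_fps_expansion_def)
qed

text \<open>The binomial theorem gives a sum up to \<open>m\<close>. Since \<open>G ^ k\<close>
  starts at order \<open>k\<close> and \<open>m choose k\<close> vanishes for \<open>k > m\<close>,
  the range can be cut at \<open>n\<close> instead, which makes it independent of
  \<open>m\<close>.\<close>

lemma fps_binomial_mult_nth:
  fixes G H :: "'a :: comm_ring_1 fps"
  assumes "fps_nth G 0 = 0"
  shows "fps_nth ((1 + G) ^ m * H) n = (\<Sum>k=0..n. of_nat (m choose k) * fps_nth (G ^ k * H) n)"
proof -
  have 0: "fps_nth (G ^ k * H) n = 0" if "n < k" for k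
    using that startsby_zero_power_prefix[OF assms, of k] by (auto simp: fps_mult_nth)
  have "(1 + G) ^ m * H = (\<Sum>k\<le>m. fps_const (of_nat (m choose k)) * (G ^ k * H))"
    by (subst add.commute, subst binomial_ring)
       (simp add: sum_distrib_right fps_of_nat mult.assoc)
  then have "fps_nth ((1 + G) ^ m * H) n = (\<Sum>k\<le>m. of_nat (m choose k) * fps_nth (G ^ k * H) n)"
    by (simp add: fps_sum_nth)
  also have "\<dots> = (\<Sum>k\<le>max m n. of_nat (m choose k) * fps_nth (G ^ k * H) n)"
    by (intro sum.mono_neutral_left) (auto simp: binomial_eq_0)
  also have "\<dots> = (\<Sum>k=0..n. of_nat (m choose k) * fps_nth (G ^ k * H) n)"
    by (intro sum.mono_neutral_right) (auto simp: 0)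
  finally show ?thesis .
qed

lemma poly_falling_poly_of_nat: "poly (falling_poly k) (of_nat m) = fact k * of_nat (m choose k)"
  by (simp add: falling_poly_def poly_prod binomial_gbinomial gbinomial_mult_fact lessThan_atLeast0)

lemma pcompose_power: "pcompose (p ^ k) q = pcompose p q ^ k"
  for p q :: "'a :: comm_semiring_1 poly"
  by (induction k) (simp_all add: pcompose_1 pcompose_mult)

lemma smult_sum_right: "smult c (\<Sum>i\<in>A. f i) = (\<Sum>i\<in>A. smult c (f i))"
  by (induction A rule: infinite_finite_induct) (simp_all add: smult_add_right)

text \<open>Exchanging the sums over the triangle \<open>i \<le> j \<le> n\<close> leaves, for each
  \<open>j\<close>, the Stirling expansion of \<open>falling_poly j\<close> evaluated at
  \<open>p\<close>.\<close>

lemma sum_S1_pcompose: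
  "(\<Sum>i=0..n. \<Sum>j=i..n. smult (S1 j i * c j) (p ^ i)) = (\<Sum>j=0..n. smult (c j) (pcompose (falling_poly j) p))"
proof -
  have "(\<Sum>i=0..n. \<Sum>j=i..n. smult (S1 j i * c j) (p ^ i)) =
      (\<Sum>j=0..n. \<Sum>i=0..j. smult (S1 j i * c j) (p ^ i))"
    by (simp add: sum.Sigma) (rule sum.reindex_bij_witness[of _ prod.swap prod.swap]; auto)
  also have "\<dots> = (\<Sum>j=0..n. smult (c j) (pcompose (falling_poly j) p))"
    by (intro sum.cong refl, subst falling_poly_eq_sum_S1)
       (simp add: pcompose_sum pcompose_smult pcompose_power pcompose_pCons smult_sum_right atMost_atLeast0 mult.commute)
  finally show ?thesis .
qed

lemma poly_eqI_of_nat: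
  fixes p q :: "'a :: {idom, ring_char_0} poly"
  assumes "\<And>m. poly p (of_nat m) = poly q (of_nat m)"
  shows "p = q"
proof (rule ccontr)
  assume "p \<noteq> q"
  then have "finite {x. poly (p - q) x = 0}"
    by (intro poly_roots_finite) simp
  then have "finite (range (of_nat :: nat \<Rightarrow> 'a))"
    by (rule rev_finite_subset) (auto simp: assms)
  then show False
    using finite_imageD[of of_nat "UNIV :: nat set"] inj_of_nat by blast
qed

section \<open>Comparison of both sides at natural numbers\<close>

theorem theorem2p9:
  fixes M :: "'a measure" and Y :: "'a \<Rightarrow> real" and Ys :: "nat \<Rightarrow> 'a \<Rightarrow> real"
    and lam :: real and n r :: nat
  assumes "prob_space M"
    and "lam \<noteq> 0"
    and "Y \<in> borel_measurable M"
    and "\<exists>\<epsilon>>0. \<forall>s. \<bar>s\<bar> < \<epsilon> \<longrightarrow> integrable M (\<lambda>\<omega>. exp (s * Y \<omega>))"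
    and "prob_space.indep_vars M (\<lambda>_. borel) Ys {1..}"
    and "\<forall>j\<ge>1. distr M borel (Ys j) = distr M borel Y"
  shows "(\<Sum>k=0..n. smult (prob_space.prob_deg_r_stirling2 M lam r Y Ys (n + r) (k + r)) (falling_poly k))
    = (\<Sum>i=0..n. \<Sum>j=i..n. smult (S1 j i * prob_space.prob_deg_stirling2 M lam Y n j) ([:of_nat r, 1:] ^ i))"
proof -
  interpret prob_space M by fact
  define A where "A = (\<lambda>t. expectation (\<lambda>\<omega>. degenerate_exp lam (Y \<omega>) t))"
  define F where "F = Abs_fps (\<lambda>n. expectation (\<lambda>\<omega>. (Y \<omega> / lam gchoose n) * lam ^ n))"
  define G where "G = F - 1"
  have A: "A has_fps_expansion F"
    and int: "\<forall>\<^sub>F t in nhds 0. integrable M (\<lambda>\<omega>. degenerate_exp lam (Y \<omega>) t)"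
    unfolding A_def F_def
    using has_fps_expansion_expectation_degenerate_exp[OF assms(2-4)] by auto
  \<comment> \<open>The constant coefficient of \<open>F\<close> is the expectation of 1, which is 1
    in a probability space.\<close>
  have F: "F = 1 + G" and G0: "fps_nth G 0 = 0"
    by (simp_all add: G_def F_def prob_space)
  have coeff_k: "(\<lambda>t. (A t - 1) ^ k / fact k) has_fps_expansion fps_const (1 / fact k) * G ^ k" for k
    using has_fps_expansion_cmult_left[of "\<lambda>t. (A t - 1) ^ k" "G ^ k" "1 / fact k"] A
    by (simp add: G_def has_fps_expansion_power_nat has_fps_expansion_diff)
  have "((\<lambda>t. 1 + lam * t) \<longlongrightarrow> 1 + lam * 0) (nhds 0)"
    by (intro tendsto_intros filterlim_ident)
  then have "\<forall>\<^sub>F t in nhds 0. 1 + lam * t > 0"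
    by (auto dest!: order_tendstoD(1)[of _ _ _ 0])
  with int have "\<forall>\<^sub>F t in nhds 0. A t ^ r = expectation (\<lambda>\<omega>. degenerate_exp lam (\<Sum>j=1..r. Ys j \<omega>) t)"
  proof eventually_elim
    case (elim t)
    then show ?case
      using expectation_degenerate_exp_sum[OF assms(3), of Ys "{1..r}" lam t]
        indep_vars_subset[OF assms(5), of "{1..r}"] assms(6)
      by (auto simp: A_def)
  qed
  then have S_r: "(\<lambda>t. expectation (\<lambda>\<omega>. degenerate_exp lam (\<Sum>j=1..r. Ys j \<omega>) t)) has_fps_expansion F ^ r"
    by (rule has_fps_expansion_eventually_cong[OF has_fps_expansion_power_nat[OF A]])
  \<comment> \<open>The factor \<open>fact k\<close> is kept on the left because
    \<open>falling_poly k\<close> at \<open>m\<close> supplies exactly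
    \<open>fact k * (m choose k)\<close>.\<close>
  have S2: "fact k * prob_deg_stirling2 lam Y n k = fact n * fps_nth (G ^ k) n" for k
    using egf_coeff_eqI[OF coeff_k, of k n]
    by (simp add: prob_deg_stirling2_def A_def)
  have S2r: "fact k * prob_deg_r_stirling2 lam r Y Ys (n + r) (k + r) = fact n * fps_nth (G ^ k * F ^ r) n" for k
    using egf_coeff_eqI[OF has_fps_expansion_mult[OF coeff_k S_r], of k n]
    by (simp add: prob_deg_r_stirling2_def A_def mult.assoc)
  show ?thesis
  proof (rule poly_eqI_of_nat)
    fix m
    have "poly (\<Sum>k=0..n. smult (prob_deg_r_stirling2 lam r Y Ys (n + r) (k + r)) (falling_poly k)) (of_nat m)
        = (\<Sum>k=0..n. of_nat (m choose k) * (fact k * prob_deg_r_stirling2 lam r Y Ys (n + r) (k + r)))"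
      by (simp add: poly_sum poly_falling_poly_of_nat mult_ac)
    also have "\<dots> = fact n * fps_nth (F ^ m * F ^ r) n"
      using fps_binomial_mult_nth[OF G0, of m "F ^ r" n]
      by (simp add: S2r F[symmetric] sum_distrib_left mult_ac)
    also have "\<dots> = fact n * fps_nth (F ^ (m + r)) n"
      by (simp add: power_add)
    \<comment> \<open>The same coefficient is expanded a second time, now with all
      \<open>m + r\<close> factors written as \<open>1 + G\<close> and with trivial cofactor
      1.\<close>
    also have "\<dots> = (\<Sum>j=0..n. of_nat ((m + r) choose j) * (fact j * prob_deg_stirling2 lam Y n j))"
      using fps_binomial_mult_nth[OF G0, of "m + r" 1 n]
      by (simp add: S2 F[symmetric] sum_distrib_left mult_ac)
    also have "\<dots> = (\<Sum>j=0..n. prob_deg_stirling2 lam Y n j * poly (falling_poly j) (of_nat (m + r)))"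
      by (simp only: poly_falling_poly_of_nat mult_ac)
    also have "\<dots> = poly (\<Sum>j=0..n. smult (prob_deg_stirling2 lam Y n j)
        (pcompose (falling_poly j) [:of_nat r, 1:])) (of_nat m)"
      by (simp add: poly_sum poly_pcompose add.commute)
    finally show "poly (\<Sum>k=0..n. smult (prob_deg_r_stirling2 lam r Y Ys (n + r) (k + r)) (falling_poly k)) (of_nat m)
        = poly (\<Sum>i=0..n. \<Sum>j=i..n. smult (S1 j i * prob_deg_stirling2 lam Y n j) ([:of_nat r, 1:] ^ i)) (of_nat m)"
      by (simp only: sum_S1_pcompose)
  qed
qed

end
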